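(* Let $T$ be a tree with vertex set $\{1,\dots,n\}$, $n\ge 2$, with edges $e_1,\dots,e_{n-1}$, let $W_i$ be the $s\times s$ weight matrix of $e_i$, $i=1,\dots,n-1$, and let $D$ be the distance matrix of $T$. Suppose $D$ is invertible, and let $L$ be the Laplacian matrix of $T$ for the weighting in which each edge weight matrix is replaced by its inverse. For $i=1,\dots,n$ set $\delta_i=2-d_i$, where $d_i$ is the degree of the vertex $i$, and $\delta^T=[\delta_1,\dots,\delta_n]$. Let $\mathbf 1$ be the all-ones column vector of length $n$ and $J$ the $n\times n$ all-ones matrix. Then: (i) $LD=\delta\mathbf 1^T\otimes I_s-2I_n\otimes I_s$; (ii) $DL=\mathbf 1\delta^T\otimes I_s-2I_n\otimes I_s$; (iii) $LDL=-2L$; (iv) $D^{-1}-L$ is invertible and $(D^{-1}-L)^{-1}=\frac13 D+\frac13 J\otimes\sum_{i=1}^{n-1}W_i$; (v) if all the weight matrices $W_i$ are positive definite, then $Q^TDQ=-2I_{(n-1)s}$, where $Q$ is the vertex-edge incidence matrix of the weighted tree $T$ (with blocks $\pm W_j^{-1/2}$).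
   Context: Matrices have real entries; positive definite matrices are symmetric. The distance matrix $D$ of $T$ is the $ns\times ns$ block matrix with $s\times s$ blocks $D_{i,j}$, where $D_{i,j}$ is the sum of the weight matrices of the edges on the unique path from $i$ to $j$ in $T$ (so $D_{i,i}=0$). If $D$ is invertible, all the $W_i$ are invertible, so $L$ is defined: it is the $ns\times ns$ block matrix whose $(i,i)$ block is the sum of $W_k^{-1}$ over all edges $e_k$ incident with $i$, and whose $(i,j)$ block for $i\ne j$ is $-W_k^{-1}$ if $e_k=\{i,j\}$ is an edge and the zero matrix otherwise. For positive definite weights, fix an orientation of each edge; $Q$ is the $ns\times(n-1)s$ block matrix whose $(i,j)$ block ($i$ a vertex, $e_j$ an edge) is $0$ if $i$ and $e_j$ are not incident, $(\sqrt{W_j})^{-1}$ if $e_j$ originates at $i$, and $-(\sqrt{W_j})^{-1}$ if $e_j$ terminates at $i$, where $\sqrt{W_j}$ is the positive definite square root. The Kronecker product is $A\otimes B=(a_{ij}B)$. *)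

theory Defs
  imports "HOL-Analysis.Analysis"
begin

text \<open>
  The vertex set \<open>{1,...,n}\<close> is the finite type \<open>'n\<close>, the edges \<open>e_1,...,e_{n-1}\<close> are indexed
  by the finite type \<open>'m\<close>, and \<open>s \<times> s\<close> matrices have the index type \<open>'s\<close>. An edge
  is the set of its two end vertices. Block matrices are indexed by pairs
  (position of the block, position inside the block). The \<open>tree\<close> of the AFP entry Graph_Theory
  concerns directed cycles, so that no symmetric digraph with an arc is a tree in its sense;
  hence the undirected notions below.
\<close>

subsection \<open>Trees\<close>

definition simple_graph :: "'n set set \<Rightarrow> bool" where
  "simple_graph E \<longleftrightarrow> (\<forall>x\<in>E. card x = 2)"

definition graph_path :: "'n set set \<Rightarrow> 'n list \<Rightarrow> bool" where
  "graph_path E p \<longleftrightarrow>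
     p \<noteq> [] \<and> distinct p \<and> (\<forall>l. Suc l < length p \<longrightarrow> {p ! l, p ! Suc l} \<in> E)"

definition path_from_to :: "'n set set \<Rightarrow> 'n \<Rightarrow> 'n \<Rightarrow> 'n list \<Rightarrow> bool" where
  "path_from_to E i j p \<longleftrightarrow> graph_path E p \<and> hd p = i \<and> last p = j"

definition graph_cycle :: "'n set set \<Rightarrow> 'n list \<Rightarrow> bool" where
  "graph_cycle E p \<longleftrightarrow> graph_path E p \<and> length p \<ge> 3 \<and> {last p, hd p} \<in> E"

definition graph_connected :: "'n set set \<Rightarrow> bool" where
  "graph_connected E \<longleftrightarrow> (\<forall>i j. \<exists>p. path_from_to E i j p)"

definition is_tree :: "'n set set \<Rightarrow> bool" where
  "is_tree E \<longleftrightarrow> simple_graph E \<and> graph_connected E \<and> \<not> (\<exists>p. graph_cycle E p)"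

definition tree_path :: "'n set set \<Rightarrow> 'n \<Rightarrow> 'n \<Rightarrow> 'n list" where
  "tree_path E i j = (THE p. path_from_to E i j p)"

definition path_edges :: "'n list \<Rightarrow> 'n set set" where
  "path_edges p = {{p ! l, p ! Suc l} | l. Suc l < length p}"

definition vertex_degree :: "('m::finite \<Rightarrow> 'n set) \<Rightarrow> 'n \<Rightarrow> nat" where
  "vertex_degree e i = card {k. i \<in> e k}"

subsection \<open>Matrices\<close>

definition block_matrix ::
  "('a::finite \<Rightarrow> 'b::finite \<Rightarrow> real^'d^'c) \<Rightarrow> real^('b \<times> 'd)^('a \<times> 'c)" where
  "block_matrix B = (\<chi> p q. B (fst p) (fst q) $ snd p $ snd q)"

definition kronecker ::
  "real^'b^'a \<Rightarrow> real^'d^'c \<Rightarrow> real^('b \<times> 'd)^('a \<times> 'c)" (infixl "\<otimes>\<^sub>K" 72) where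
  "A \<otimes>\<^sub>K B = block_matrix (\<lambda>i j. (A $ i $ j) *\<^sub>R B)"

definition positive_definite :: "real^'s^'s \<Rightarrow> bool" where
  "positive_definite A \<longleftrightarrow> transpose A = A \<and> (\<forall>x. x \<noteq> 0 \<longrightarrow> x \<bullet> (A *v x) > 0)"

definition pd_sqrt :: "real^'s^'s \<Rightarrow> real^'s^'s" where
  "pd_sqrt A = (THE S. positive_definite S \<and> S ** S = A)"

subsection \<open>Matrices of a weighted tree\<close>

definition distance_matrix ::
  "('m::finite \<Rightarrow> 'n::finite set) \<Rightarrow> ('m \<Rightarrow> real^'s^'s) \<Rightarrow> real^('n \<times> 's)^('n \<times> 's)" where
  "distance_matrix e W =
     block_matrix (\<lambda>i j. \<Sum>k | e k \<in> path_edges (tree_path (range e) i j). W k)"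

definition laplacian_matrix ::
  "('m::finite \<Rightarrow> 'n::finite set) \<Rightarrow> ('m \<Rightarrow> real^'s^'s) \<Rightarrow> real^('n \<times> 's)^('n \<times> 's)" where
  "laplacian_matrix e W = block_matrix (\<lambda>i j.
     if i = j then (\<Sum>k | i \<in> e k. W k)
     else if {i, j} \<in> range e then - W (THE k. e k = {i, j})
     else 0)"

text \<open>
  An orientation is given by the maps \<open>src\<close> and \<open>tgt\<close>: the edge \<open>k\<close> originates at \<open>src k\<close>
  and terminates at \<open>tgt k\<close>.
\<close>

definition orientation :: "('m \<Rightarrow> 'n set) \<Rightarrow> ('m \<Rightarrow> 'n) \<Rightarrow> ('m \<Rightarrow> 'n) \<Rightarrow> bool" where
  "orientation e src tgt \<longleftrightarrow> (\<forall>k. e k = {src k, tgt k})"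

definition incidence_matrix ::
  "('m::finite \<Rightarrow> 'n::finite) \<Rightarrow> ('m \<Rightarrow> 'n) \<Rightarrow> ('m \<Rightarrow> real^'s^'s) \<Rightarrow> real^('m \<times> 's)^('n \<times> 's)" where
  "incidence_matrix src tgt W = block_matrix (\<lambda>i k.
     if i = src k then matrix_inv (pd_sqrt (W k))
     else if i = tgt k then - matrix_inv (pd_sqrt (W k))
     else 0)"

end

theory Submission
  imports Defs
begin

text \<open>
  Orient the edges, let \<open>\<beta>\<^sub>k\<close> be the difference of the unit vectors at the ends of \<open>e\<^sub>k\<close>, and let
  \<open>\<sigma>\<^sub>k\<close> be \<open>1\<close> on one side of \<open>e\<^sub>k\<close> and \<open>-1\<close> on the other. An edge lies on the path from \<open>i\<close> to
  \<open>j\<close> iff it separates them, so \<open>D = \<Sum>\<^sub>k (J - \<sigma>\<^sub>k \<sigma>\<^sub>k\<^sup>T)/2 \<otimes> W\<^sub>k\<close>, while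
  \<open>L = \<Sum>\<^sub>k \<beta>\<^sub>k \<beta>\<^sub>k\<^sup>T \<otimes> W\<^sub>k\<^sup>-\<^sup>1\<close>. As \<open>\<beta>\<^sub>k\<close> is orthogonal to the all-ones vector and
  \<open>\<beta>\<^sub>k \<bullet> \<sigma>\<^sub>l\<close> is \<open>2\<close> for \<open>k = l\<close> and \<open>0\<close> otherwise, \<open>LD\<close> collapses to \<open>- \<Sum>\<^sub>k \<beta>\<^sub>k \<sigma>\<^sub>k\<^sup>T \<otimes> I\<close>; and
  \<open>\<Sum>\<^sub>k \<beta>\<^sub>k \<sigma>\<^sub>k\<^sup>T = 2 I - \<delta> 1\<^sup>T\<close> because exactly one edge at \<open>i\<close> separates \<open>i\<close> from \<open>j \<noteq> i\<close>.
  Multiplying this identity by \<open>\<sigma>\<^sub>k\<^sup>T\<close> gives \<open>\<sigma>\<^sub>k \<bullet> \<delta> = 0\<close>, hence \<open>D (\<delta> \<otimes> I) = 1 \<otimes> \<Sum>\<^sub>k W\<^sub>k\<close>, which is what (iv)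
  needs.
\<close>

subsection \<open>Square roots of positive definite matrices\<close>

text \<open>A maximiser of the Rayleigh quotient on the compact unit sphere of \<open>S\<close> is
  an eigenvector. Working inside an invariant subspace allows the lemma to be reapplied to
  orthogonal complements.\<close>

lemma symmetric_operator_eigenvector:
  fixes f :: "'a::euclidean_space \<Rightarrow> 'a"
  assumes f: "linear f" and sym: "\<And>x y. f x \<bullet> y = x \<bullet> f y"
    and S: "subspace S" "S \<noteq> {0}" and inv: "f ` S \<subseteq> S"
  obtains u where "u \<in> S" "norm u = 1" "f u = (u \<bullet> f u) *\<^sub>R u"
proof -
  interpret f: linear f by fact
  let ?K = "S \<inter> sphere 0 1"
  have "compact ?K"
    using closed_subspace[OF S(1)] by (simp add: closed_Int_compact)
  moreover obtain z where z: "z \<in> S" "z \<noteq> 0"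
    using S subspace_0 by blast
  have "(1 / norm z) *\<^sub>R z \<in> ?K"
    using z S(1) by (simp add: subspace_scale)
  then have "?K \<noteq> {}" by blast
  moreover have "continuous_on ?K (\<lambda>x. x \<bullet> f x)"
    by (intro continuous_intros linear_continuous_on linear_conv_bounded_linear[THEN iffD1] f)
  ultimately obtain u where u: "u \<in> ?K" and max: "\<And>y. y \<in> ?K \<Longrightarrow> y \<bullet> f y \<le> u \<bullet> f u"
    using continuous_attains_sup[of ?K "\<lambda>x. x \<bullet> f x"] by blast
  define \<mu> where "\<mu> = u \<bullet> f u"
  \<comment> \<open>\<open>g\<close> is the quadratic form of \<mu> I - f: nonnegative on
    \<open>S\<close> by maximality and homogeneity, and zero at \<open>u\<close>.\<close>
  define g where "g = (\<lambda>y. \<mu> * (y \<bullet> y) - y \<bullet> f y)"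
  have g_nonneg: "g y \<ge> 0" if "y \<in> S" for y
  proof (cases "y = 0")
    case False
    have "(1 / norm y) *\<^sub>R y \<in> ?K"
      using that False S(1) by (simp add: subspace_scale)
    from max[OF this] have "(y \<bullet> f y) / (norm y * norm y) \<le> \<mu>"
      by (simp add: f.scaleR \<mu>_def)
    then show ?thesis
      using False by (simp add: g_def field_simps dot_square_norm power2_eq_square)
  qed (simp add: g_def f.zero)
  have uu: "u \<bullet> u = 1" using u by (simp add: dot_square_norm)
  define w where "w = \<mu> *\<^sub>R u - f u"
  have wS: "w \<in> S" unfolding w_def
    using u inv S(1) by (intro subspace_diff subspace_scale) auto
  have exp: "g (u + t *\<^sub>R w) = 2 * t * (w \<bullet> w) + t\<^sup>2 * g w" for t
  proof -
    have "u \<bullet> f w = f u \<bullet> w" "w \<bullet> f u = f u \<bullet> w" "w \<bullet> u = u \<bullet> w"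
      by (rule sym[symmetric] inner_commute)+
    then have "g (u + t *\<^sub>R w) = 2 * t * (\<mu> * (u \<bullet> w) - f u \<bullet> w) + t\<^sup>2 * g w"
      unfolding g_def using uu \<mu>_def
      by (simp add: f.add f.scaleR inner_add_left inner_add_right algebra_simps power2_eq_square)
    moreover have "w \<bullet> w = \<mu> * (u \<bullet> w) - f u \<bullet> w"
      by (subst w_def) (simp add: inner_diff_left)
    ultimately show ?thesis by simp
  qed
  \<comment> \<open>\<open>u\<close> minimises \<open>g\<close> on \<open>S\<close>, so the derivative of \<open>g\<close> along \<open>w\<close> vanishes at \<open>u\<close>.\<close>
  have ge: "2 * t * (w \<bullet> w) + t\<^sup>2 * g w \<ge> 0" for t
    using exp[of t] g_nonneg[of "u + t *\<^sub>R w"] u wS S(1)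
    by (simp add: subspace_add subspace_scale)
  have "w \<bullet> w = 0"
  \<comment> \<open>If \<open>g w = 0\<close>, the bound is linear in t and t = -1 suffices.
    Otherwise the minimiser t = -(w \<bullet> w) / g w turns the bound into -(w \<bullet> w)^2 / g w
    \<ge> 0.\<close>
  proof (cases "g w = 0")
    case True
    then show ?thesis using ge[of "-1"] inner_ge_zero[of w] by simp
  next
    case False
    then have "g w > 0" using g_nonneg[OF wS] by simp
    then have "- ((w \<bullet> w)\<^sup>2 / g w) \<ge> 0"
      using ge[of "- (w \<bullet> w) / g w"] by (simp add: field_simps power2_eq_square)
    then show ?thesis using \<open>g w > 0\<close> by (simp add: field_simps)
  qed
  then have "f u = \<mu> *\<^sub>R u" by (simp add: w_def)
  with u show ?thesis by (intro that) (auto simp: \<mu>_def)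
qed

text \<open>Take an orthonormal set of eigenvectors of maximal size. Its orthogonal complement is
  invariant, so a nonzero complement would supply one more eigenvector. For a unit vector
  \<open>v\<close> the eigenvalue is \<open>v \<bullet> f v\<close>, so eigenvalues need no names of
  their own.\<close>

lemma symmetric_operator_eigenbasis:
  fixes f :: "'a::euclidean_space \<Rightarrow> 'a"
  assumes f: "linear f" and sym: "\<And>x y. f x \<bullet> y = x \<bullet> f y"
  obtains B where "finite B" "pairwise orthogonal B" "\<And>v. v \<in> B \<Longrightarrow> norm v = 1"
    "\<And>v. v \<in> B \<Longrightarrow> f v = (v \<bullet> f v) *\<^sub>R v" "\<And>x. x = (\<Sum>v\<in>B. (v \<bullet> x) *\<^sub>R v)"
proof -
  let ?P = "\<lambda>B. pairwise orthogonal B \<and> (\<forall>v\<in>B. norm v = 1 \<and> f v = (v \<bullet> f v) *\<^sub>R v)"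
  have bound: "finite B \<and> card B \<le> DIM('a)" if "?P B" for B
  proof -
    have "0 \<notin> B" using that by force
    then show ?thesis
      using that pairwise_orthogonal_independent[of B] independent_bound[of B] by simp
  qed
  have "\<exists>B. ?P B \<and> (\<forall>C. ?P C \<longrightarrow> card C \<le> card B)"
    by (rule ex_has_greatest_nat[of ?P "{}" card "Suc (DIM('a))"])
      (simp, use bound in \<open>simp only: less_Suc_eq_le, blast\<close>)
  then obtain B where B: "?P B" and max: "\<And>C. ?P C \<Longrightarrow> card C \<le> card B"
    by blast
  let ?S = "{x. \<forall>v\<in>B. orthogonal v x}"
  have "?S = {0}"
  proof (rule ccontr)
    assume ne: "?S \<noteq> {0}"
    have sub: "subspace ?S"
      by (auto simp: subspace_def orthogonal_def inner_add_right)
    have "f ` ?S \<subseteq> ?S"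
    proof clarify
      fix x v assume x: "\<forall>v\<in>B. orthogonal v x" and v: "v \<in> B"
      have "v \<bullet> f x = f v \<bullet> x" by (simp add: sym)
      also have "\<dots> = ((v \<bullet> f v) *\<^sub>R v) \<bullet> x"
        using B v by (intro arg_cong2[where f = inner]) auto
      also have "\<dots> = (v \<bullet> f v) * (v \<bullet> x)" by simp
      finally show "orthogonal v (f x)" using x v by (simp add: orthogonal_def)
    qed
    then obtain u where u: "u \<in> ?S" "norm u = 1" "f u = (u \<bullet> f u) *\<^sub>R u"
      using symmetric_operator_eigenvector[OF f sym sub ne] by metis
    have "u \<notin> B" using u by (auto simp: orthogonal_def)
    have "?P (insert u B)"
      using u B by (auto simp: pairwise_insert orthogonal_commute)
    from max[OF this] show False using \<open>u \<notin> B\<close> bound[OF B] by simp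
  qed
  have fin: "finite B" using bound[OF B] by simp
  have "x = (\<Sum>v\<in>B. (v \<bullet> x) *\<^sub>R v)" for x
  proof -
    have "v \<bullet> (\<Sum>w\<in>B. (w \<bullet> x) *\<^sub>R w) = v \<bullet> x" if v: "v \<in> B" for v
    proof -
      have "v \<bullet> (\<Sum>w\<in>B. (w \<bullet> x) *\<^sub>R w) = (\<Sum>w\<in>B. if w = v then v \<bullet> x else 0)"
        unfolding inner_sum_right using B v
        by (intro sum.cong) (auto simp: pairwise_def orthogonal_def dot_square_norm)
      then show ?thesis using fin v by simp
    qed
    \<comment> \<open>The remainder of the expansion is orthogonal to \<open>B\<close>, hence lies
      in the trivial complement.\<close>
    then have "x - (\<Sum>v\<in>B. (v \<bullet> x) *\<^sub>R v) \<in> ?S"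
      by (simp add: orthogonal_def inner_diff_right)
    then show ?thesis using \<open>?S = {0}\<close> by auto
  qed
  with fin B show ?thesis by (intro that) auto
qed

lemma symmetric_matrix_inner:
  fixes A :: "real^'s^'s"
  assumes "transpose A = A"
  shows "(A *v x) \<bullet> y = x \<bullet> (A *v y)"
  by (metis assms dot_lmul_matrix inner_commute transpose_matrix_vector)

text \<open>In an orthonormal eigenbasis of \<open>A\<close>, scale each eigenvector by the square
  root of its positive eigenvalue.\<close>

lemma pd_sqrt_exists:
  fixes A :: "real^'s^'s"
  assumes "positive_definite A"
  obtains S where "positive_definite S" "S ** S = A"
proof -
  have sym: "(A *v x) \<bullet> y = x \<bullet> (A *v y)" for x y
    using assms symmetric_matrix_inner by (auto simp: positive_definite_def)
  obtain B where B: "finite B" "pairwise orthogonal B" "\<And>v. v \<in> B \<Longrightarrow> norm v = 1"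
    "\<And>v. v \<in> B \<Longrightarrow> A *v v = (v \<bullet> (A *v v)) *\<^sub>R v" "\<And>x. x = (\<Sum>v\<in>B. (v \<bullet> x) *\<^sub>R v)"
    by (rule symmetric_operator_eigenbasis[OF matrix_vector_mul_linear, of A]) (rule sym, rule that)
  define r where "r = (\<lambda>v. sqrt (v \<bullet> (A *v v)))"
  have pos: "v \<bullet> (A *v v) > 0" if "v \<in> B" for v
  proof -
    have "v \<noteq> 0" using B(3)[OF that] by auto
    then show ?thesis using assms by (simp add: positive_definite_def)
  qed
  define g where "g = (\<lambda>x. \<Sum>v\<in>B. (r v * (v \<bullet> x)) *\<^sub>R v)"
  have lin: "linear g"
    by (rule linearI) (simp_all add: g_def inner_add_right algebra_simps sum.distrib scaleR_sum_right)
  have inner_g: "v \<bullet> g x = r v * (v \<bullet> x)" if v: "v \<in> B" for v x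
  proof -
    have "v \<bullet> g x = (\<Sum>w\<in>B. if w = v then r v * (v \<bullet> x) else 0)"
      unfolding g_def inner_sum_right using B(1-3) v
      by (intro sum.cong) (auto simp: pairwise_def orthogonal_def dot_square_norm)
    then show ?thesis using B(1) v by simp
  qed
  have gg: "g (g x) = A *v x" for x
  proof -
    have "g (g x) = (\<Sum>v\<in>B. (r v * (v \<bullet> g x)) *\<^sub>R v)"
      by (rule g_def[THEN fun_cong])
    also have "\<dots> = (\<Sum>v\<in>B. (v \<bullet> x) *\<^sub>R (A *v v))"
    proof (intro sum.cong refl)
      fix v assume v: "v \<in> B"
      have "r v * (v \<bullet> g x) = (v \<bullet> x) * (v \<bullet> (A *v v))"
        using pos[OF v] by (simp add: inner_g[OF v] r_def)
      then show "(r v * (v \<bullet> g x)) *\<^sub>R v = (v \<bullet> x) *\<^sub>R (A *v v)"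
        using B(4)[OF v] by (metis scaleR_scaleR)
    qed
    also have "\<dots> = A *v (\<Sum>v\<in>B. (v \<bullet> x) *\<^sub>R v)"
      by (simp add: linear_sum[OF matrix_vector_mul_linear] matrix_vector_mult_scaleR)
    finally show ?thesis by (simp only: B(5)[of x, symmetric])
  qed
  have g_sym: "g x \<bullet> y = x \<bullet> g y" for x y
    by (simp add: g_def inner_sum_left inner_sum_right inner_commute ac_simps)
  have g_pos: "x \<bullet> g x > 0" if "x \<noteq> 0" for x
  proof -
    have "x \<bullet> g x = (\<Sum>v\<in>B. r v * (v \<bullet> x)\<^sup>2)"
      by (simp add: g_def inner_sum_right inner_commute ac_simps power2_eq_square)
    moreover obtain v where "v \<in> B" "v \<bullet> x \<noteq> 0"
    proof (rule ccontr)
      assume "\<not> thesis"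
      with that have "(\<Sum>v\<in>B. (v \<bullet> x) *\<^sub>R v) = 0"
        by (intro sum.neutral) auto
      with \<open>x \<noteq> 0\<close> show False by (simp only: B(5)[of x, symmetric])
    qed
    ultimately show ?thesis
      using B(1) pos by (auto intro!: sum_pos2[of _ v] mult_pos_pos simp: r_def less_imp_le)
  qed
  have mv: "matrix g *v x = g x" for x
    using lin by (simp add: matrix_works)
  show ?thesis
  proof
    have "transpose (matrix g) = matrix g"
      using g_sym by (metis adjoint_unique lin matrix_adjoint)
    then show "positive_definite (matrix g)"
      using g_pos by (simp add: positive_definite_def mv)
    show "matrix g ** matrix g = A"
      by (simp add: matrix_eq mv gg flip: matrix_vector_mul_assoc)
  qed
qed

text \<open>Only \<open>S - T\<close> is diagonalised: it is zero once it vanishes on its own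
  eigenbasis.\<close>

lemma pd_sqrt_unique:
  fixes S T :: "real^'s^'s"
  assumes S: "positive_definite S" and T: "positive_definite T" and eq: "S ** S = T ** T"
  shows "S = T"
proof -
  let ?d = "\<lambda>x. (S - T) *v x"
  have "transpose (S - T) = S - T"
    using S T by (simp add: positive_definite_def transpose_def vec_eq_iff)
  note sym = symmetric_matrix_inner[OF this]
  have symS: "(S *v x) \<bullet> y = x \<bullet> (S *v y)" and symT: "(T *v x) \<bullet> y = x \<bullet> (T *v y)" for x y
    using S T symmetric_matrix_inner by (auto simp: positive_definite_def)
  obtain B where B: "\<And>v. v \<in> B \<Longrightarrow> norm v = 1" "\<And>v. v \<in> B \<Longrightarrow> ?d v = (v \<bullet> ?d v) *\<^sub>R v"
     "\<And>x. x = (\<Sum>v\<in>B. (v \<bullet> x) *\<^sub>R v)"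
    by (rule symmetric_operator_eigenbasis[OF matrix_vector_mul_linear, of "S - T"]) (rule sym, rule that)
  \<comment> \<open>\<open>S\<^sup>2 - T\<^sup>2\<close> is the symmetrisation of \<open>(S - T) (S + T)\<close>, so an eigenvector of \<open>S - T\<close> with
    eigenvalue \<open>\<mu>\<close> satisfies \<open>0 = \<mu> (v \<bullet> (S + T) v)\<close>.\<close>
  have "?d v = 0" if v: "v \<in> B" for v
  proof -
    have "0 = v \<bullet> (S *v (S *v v)) - v \<bullet> (T *v (T *v v))"
      by (simp add: matrix_vector_mul_assoc eq)
    also have "\<dots> = (S *v v) \<bullet> (S *v v) - (T *v v) \<bullet> (T *v v)"
      by (simp add: symS symT)
    also have "\<dots> = ?d v \<bullet> ((S *v v) + (T *v v))"
      by (simp add: algebra_simps inner_diff_left inner_add_right inner_commute)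
    also have "\<dots> = (v \<bullet> ?d v) * (v \<bullet> (S *v v) + v \<bullet> (T *v v))"
      by (subst B(2)[OF v]) (simp add: inner_add_right distrib_left)
    finally have *: "0 = (v \<bullet> ?d v) * (v \<bullet> (S *v v) + v \<bullet> (T *v v))" .
    have "v \<noteq> 0" using B(1)[OF v] by auto
    then have "v \<bullet> (S *v v) + v \<bullet> (T *v v) > 0"
      using S T by (simp add: positive_definite_def add_pos_pos)
    with * show ?thesis using B(2)[OF v] by simp
  qed
  then have "?d x = 0" for x
    by (subst B(3)[of x]) (simp add: linear_sum[OF matrix_vector_mul_linear] matrix_vector_mult_scaleR)
  then show ?thesis by (simp add: matrix_eq algebra_simps)
qed

lemma pd_sqrt:
  fixes A :: "real^'s^'s"
  assumes "positive_definite A"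
  shows "positive_definite (pd_sqrt A)" "pd_sqrt A ** pd_sqrt A = A"
proof -
  have "\<exists>!S. positive_definite S \<and> S ** S = A"
    using pd_sqrt_exists[OF assms] pd_sqrt_unique by metis
  from theI'[OF this] show "positive_definite (pd_sqrt A)" "pd_sqrt A ** pd_sqrt A = A"
    by (simp_all add: pd_sqrt_def)
qed

subsection \<open>Paths and edge cuts in trees\<close>

lemma graph_path_singleton [simp]: "graph_path E [x]"
  by (simp add: graph_path_def)

text \<open>Recursive form of the index-based definition, on which the list inductions rest.\<close>

lemma graph_path_Cons2:
  "graph_path E (x # y # p) \<longleftrightarrow> {x, y} \<in> E \<and> x \<notin> set (y # p) \<and> graph_path E (y # p)"
  by (simp add: graph_path_def All_less_Suc2) blast

lemma graph_path_suffix: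
  assumes "graph_path E (q @ r)" "r \<noteq> []"
  shows "graph_path E r"
  using assms
proof (induction q)
  case (Cons x q)
  then show ?case by (cases "q @ r") (auto simp: graph_path_Cons2)
qed simp

lemma path_edges_singleton [simp]: "path_edges [x] = {}"
  by (simp add: path_edges_def)

lemma path_edges_Cons2: "path_edges (x # y # p) = insert {x, y} (path_edges (y # p))"
proof -
  have "f \<in> path_edges (x # y # p) \<longleftrightarrow> f \<in> insert {x, y} (path_edges (y # p))" for f
  proof -
    have "f \<in> path_edges (x # y # p) \<longleftrightarrow>
      (\<exists>l < Suc (length p). f = {(x # y # p) ! l, (x # y # p) ! Suc l})"
      by (auto simp: path_edges_def)
    also have "\<dots> \<longleftrightarrow> f = {x, y} \<or> (\<exists>l < length p. f = {(y # p) ! l, (y # p) ! Suc l})"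
      by (simp add: Ex_less_Suc2)
    also have "\<dots> \<longleftrightarrow> f \<in> insert {x, y} (path_edges (y # p))"
      by (auto simp: path_edges_def)
    finally show ?thesis .
  qed
  then show ?thesis by blast
qed

lemma path_edges_subset: "f \<in> path_edges p \<Longrightarrow> f \<subseteq> set p"
  by (auto simp: path_edges_def)

text \<open>Walks rather than paths: without distinctness, reachability is visibly constant along
  edges. With one edge deleted from a tree it describes one side of the cut.\<close>

definition reachable :: "'n set set \<Rightarrow> 'n \<Rightarrow> 'n \<Rightarrow> bool" where
  "reachable E = (\<lambda>x y. {x, y} \<in> E)\<^sup>*\<^sup>*"

lemma reachable_refl [simp]: "reachable E x x"
  by (simp add: reachable_def)

lemma reachable_edge_iff:
  assumes "{x, y} \<in> E"
  shows "reachable E u x \<longleftrightarrow> reachable E u y"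
  using assms unfolding reachable_def
  by (metis (no_types, lifting) insert_commute rtranclp.rtrancl_into_rtrancl)

text \<open>Loop erasure: a new first vertex is prepended, unless the path already visits it; then
  the path is cut back to start there.\<close>

lemma reachable_imp_path:
  assumes "reachable E x y"
  shows "\<exists>p. path_from_to E x y p"
  using assms unfolding reachable_def
proof (induction rule: converse_rtranclp_induct)
  case base
  have "path_from_to E y y [y]" by (simp add: path_from_to_def)
  then show ?case ..
next
  case (step x z)
  then obtain p where p: "graph_path E p" "hd p = z" "last p = y"
    by (auto simp: path_from_to_def)
  then obtain p' where p': "p = z # p'" by (cases p) (auto simp: graph_path_def)
  show ?case
  proof (cases "x \<in> set p")
    case True
    then obtain q r where "p = q @ x # r" by (auto simp: in_set_conv_decomp)
    with p have "path_from_to E x y (x # r)"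
      using graph_path_suffix[of E q "x # r"] by (auto simp: path_from_to_def)
    then show ?thesis ..
  next
    case False
    with p p' step(1) have "path_from_to E x y (x # p)"
      by (auto simp: path_from_to_def graph_path_Cons2)
    then show ?thesis ..
  qed
qed

text \<open>A path joining the ends of an edge while avoiding it would close up with that edge to a
  cycle.\<close>

lemma tree_edge_cut:
  assumes "is_tree E" "{u, w} \<in> E"
  shows "\<not> reachable (E - {{u, w}}) u w"
proof
  assume "reachable (E - {{u, w}}) u w"
  then obtain p where p: "graph_path (E - {{u, w}}) p" "hd p = u" "last p = w"
    using reachable_imp_path unfolding path_from_to_def by metis
  have "u \<noteq> w" using assms by (auto simp: is_tree_def simple_graph_def)
  \<comment> \<open>A single vertex is excluded by \<open>u \<noteq> w\<close>, and two vertices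
    would use the deleted edge.\<close>
  have "length p \<ge> 3"
  proof (rule ccontr)
    assume "\<not> length p \<ge> 3"
    moreover have "p \<noteq> []" using p by (simp add: graph_path_def)
    ultimately have "length p = 1 \<or> length p = 2"
      by (simp add: less_Suc_eq numeral_eq_Suc not_le)
    then consider x where "p = [x]" | x y where "p = [x, y]"
      by (auto simp: length_Suc_conv numeral_2_eq_2)
    then show False using p \<open>u \<noteq> w\<close> by cases (auto simp: graph_path_Cons2)
  qed
  moreover have "graph_path E p" using p by (auto simp: graph_path_def)
  ultimately have "graph_cycle E p"
    using p assms by (simp add: graph_cycle_def insert_commute)
  then show False using assms by (auto simp: is_tree_def)
qed

text \<open>\<open>s\<close> is the side of \<open>u\<close> after deleting the edge. Along a path
  the side changes exactly when the edge is traversed, so membership of an edge depends only on the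
  ends of the path.\<close>

lemma tree_path_edges_iff:
  assumes tree: "is_tree E" and f: "{u, w} \<in> E" and p: "graph_path E p"
  defines "s \<equiv> reachable (E - {{u, w}}) u"
  shows "{u, w} \<in> path_edges p \<longleftrightarrow> s (hd p) \<noteq> s (last p)"
  using p
proof (induction p rule: induct_list012)
  case (3 x y p)
  have step: "s x \<noteq> s y \<longleftrightarrow> {x, y} = {u, w}"
  proof (cases "{x, y} = {u, w}")
    case True
    moreover have "s u" "\<not> s w" using tree_edge_cut[OF tree f] by (simp_all add: s_def)
    ultimately show ?thesis by (metis doubleton_eq_iff)
  next
    case False
    with 3(3) have "{x, y} \<in> E - {{u, w}}" by (simp add: graph_path_Cons2)
    from reachable_edge_iff[OF this] show ?thesis using False by (simp add: s_def)
  qed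
  \<comment> \<open>Vertices of a path are distinct, so the edge is not traversed twice and the side
    never switches back.\<close>
  have "{u, w} \<notin> path_edges (y # p)" if "{x, y} = {u, w}"
    using that 3(3) path_edges_subset[of "{u, w}" "y # p"] by (auto simp: graph_path_Cons2)
  moreover have "{u, w} \<in> path_edges (y # p) \<longleftrightarrow> s y \<noteq> s (last (y # p))"
    using 3(2,3) by (simp add: graph_path_Cons2)
  moreover have "{u, w} \<in> path_edges (x # y # p) \<longleftrightarrow>
      {x, y} = {u, w} \<or> {u, w} \<in> path_edges (y # p)"
    by (simp add: path_edges_Cons2 eq_commute)
  moreover have "last (x # y # p) = last (y # p)" by simp
  ultimately show ?case using step unfolding list.sel by metis
qed (auto simp: graph_path_def)

lemma path_edges_at_start:
  assumes "graph_path E (x # y # p)" "f \<in> path_edges (x # y # p)" "x \<in> f"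
  shows "f = {x, y}"
  using assms path_edges_subset[of f "y # p"] by (auto simp: path_edges_Cons2 graph_path_Cons2)

text \<open>The cut criterion puts the first edge of one path on the other path as well. There it
  contains the starting vertex, so it is the first edge there too, and the tails agree by
  induction.\<close>

lemma tree_path_unique:
  assumes tree: "is_tree E" and p: "path_from_to E i j p" and q: "path_from_to E i j q"
  shows "p = q"
  using p q
proof (induction p arbitrary: i q rule: induct_list012)
  case 1
  then show ?case by (simp add: path_from_to_def graph_path_def)
next
  case (2 x)
  then show ?case
    by (cases q) (auto simp: path_from_to_def graph_path_def split: if_splits)
next
  case (3 x y p)
  then have i: "x = i" and p: "graph_path E (i # y # p)" "last (y # p) = j"
    by (auto simp: path_from_to_def)
  have "j \<in> set (y # p)" using p last_in_set by blast
  then have "i \<noteq> j" using p by (auto simp: graph_path_Cons2)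
  have q: "graph_path E q" "hd q = i" "last q = j" using 3 by (auto simp: path_from_to_def)
  then obtain z q' where q': "q = i # z # q'"
    using \<open>i \<noteq> j\<close> by (cases q; cases "tl q") (auto simp: graph_path_def)
  have e: "{i, y} \<in> E" using p by (simp add: graph_path_Cons2)
  have "{i, y} \<in> path_edges (i # y # p)" by (simp add: path_edges_Cons2)
  then have "{i, y} \<in> path_edges q"
    using tree_path_edges_iff[OF tree e p(1)] tree_path_edges_iff[OF tree e q(1)] p q by simp
  then have "{i, y} = {i, z}" using q(1) q' path_edges_at_start[of E i z q'] by simp
  then have "y = z" by (auto simp: doubleton_eq_iff)
  have "y # p = z # q'"
  proof (rule "3.IH"(2))
    show "path_from_to E y j (y # p)" using p by (simp add: path_from_to_def graph_path_Cons2)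
    show "path_from_to E y j (z # q')" using q q' \<open>y = z\<close>
      by (simp add: path_from_to_def graph_path_Cons2)
  qed
  then show ?case using q' i by simp
qed

lemma path_from_to_tree_path:
  assumes "is_tree E"
  shows "path_from_to E i j (tree_path E i j)"
proof -
  have "\<exists>!p. path_from_to E i j p"
  proof -
    obtain p where "path_from_to E i j p"
      using assms unfolding is_tree_def graph_connected_def by blast
    then show ?thesis using tree_path_unique[OF assms] by (intro ex1I)
  qed
  then show ?thesis unfolding tree_path_def by (rule theI')
qed

text \<open>The path leaves \<open>i\<close> along its first edge and never returns to
  \<open>i\<close>. This is the count behind \<open>incidence_sign_sum\<close>.\<close>

lemma tree_path_start_edge:
  assumes "is_tree E" "i \<noteq> j"
  shows "\<exists>!f. f \<in> path_edges (tree_path E i j) \<and> i \<in> f \<and> f \<in> E"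
proof -
  note p = path_from_to_tree_path[OF assms(1), of i j]
  then obtain z q where q: "tree_path E i j = i # z # q"
    using assms(2)
    by (cases "tree_path E i j"; cases "tl (tree_path E i j)")
       (auto simp: path_from_to_def graph_path_def)
  show ?thesis
  proof
    show "{i, z} \<in> path_edges (tree_path E i j) \<and> i \<in> {i, z} \<and> {i, z} \<in> E"
      using p q by (simp add: path_edges_Cons2 path_from_to_def graph_path_Cons2)
  next
    fix f assume "f \<in> path_edges (tree_path E i j) \<and> i \<in> f \<and> f \<in> E"
    then show "f = {i, z}"
      using p q path_edges_at_start[of E i z q f] by (simp add: path_from_to_def)
  qed
qed

lemma tree_path_self: "is_tree E \<Longrightarrow> tree_path E i i = [i]"
  by (rule tree_path_unique[OF _ path_from_to_tree_path]) (auto simp: path_from_to_def)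

text \<open>\<open>\<sigma> k\<close> is 1 on the side of \<open>src k\<close> after deleting the
  edge \<open>k\<close>, and -1 on the other side. Any other edge has both ends on one side, and the
  product of two signs records whether the edge separates the vertices.\<close>

lemma tree_edge_signs:
  fixes e :: "'m::finite \<Rightarrow> 'n::finite set" and src tgt :: "'m \<Rightarrow> 'n"
  assumes tree: "is_tree (range e)" and inj: "inj e" and ori: "orientation e src tgt"
  obtains \<sigma> :: "'m \<Rightarrow> real^'n" where
    "\<And>k i. \<sigma> k $ i = 1 \<or> \<sigma> k $ i = -1"
    "\<And>k l. \<sigma> k $ src l - \<sigma> k $ tgt l = (if k = l then 2 else 0)"
    "\<And>k i j. of_bool (e k \<in> path_edges (tree_path (range e) i j)) = (1 - \<sigma> k $ i * \<sigma> k $ j) / 2"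
proof -
  define s where "s = (\<lambda>k. reachable (range e - {e k}) (src k))"
  define \<sigma> :: "'m \<Rightarrow> real^'n" where "\<sigma> = (\<lambda>k. \<chi> i. if s k i then 1 else -1)"
  have e: "e k = {src k, tgt k}" for k using ori by (simp add: orientation_def)
  have E: "{src k, tgt k} \<in> range e" for k using e[of k] by (metis rangeI)
  have cut: "s k (src k)" "\<not> s k (tgt k)" for k
    using tree_edge_cut[OF tree E] by (auto simp: s_def e)
  have same: "s k (src l) \<longleftrightarrow> s k (tgt l)" if "k \<noteq> l" for k l
  proof -
    have "{src l, tgt l} \<in> range e - {e k}" using that inj by (simp add: inj_eq flip: e)
    then show ?thesis unfolding s_def by (rule reachable_edge_iff)
  qed
  have sep: "e k \<in> path_edges (tree_path (range e) i j) \<longleftrightarrow> s k i \<noteq> s k j" for k i j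
  proof -
    have p: "graph_path (range e) (tree_path (range e) i j)" "hd (tree_path (range e) i j) = i"
      "last (tree_path (range e) i j) = j"
      using path_from_to_tree_path[OF tree, of i j] by (auto simp: path_from_to_def)
    show ?thesis using tree_path_edges_iff[OF tree E[of k] p(1)] p by (simp add: s_def e)
  qed
  show ?thesis
    by (rule that[of \<sigma>]) (use cut same sep in \<open>auto simp: \<sigma>_def\<close>)
qed

text \<open>Each edge at \<open>i\<close> contributes 1, or -1 if it lies on the path to
  \<open>j\<close>; for \<open>i \<noteq> j\<close> the latter happens exactly once.\<close>

lemma incidence_sign_sum:
  fixes e :: "'m::finite \<Rightarrow> 'n::finite set" and \<sigma> :: "'m \<Rightarrow> real^'n"
  assumes tree: "is_tree (range e)" and inj: "inj e"
    and sep: "\<And>k i j. of_bool (e k \<in> path_edges (tree_path (range e) i j)) = (1 - \<sigma> k $ i * \<sigma> k $ j) / 2"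
  shows "(\<Sum>k | i \<in> e k. \<sigma> k $ i * \<sigma> k $ j) = real (vertex_degree e i) - 2 * of_bool (i \<noteq> j)"
proof -
  let ?P = "\<lambda>k. e k \<in> path_edges (tree_path (range e) i j)"
  have sep_sum: "(\<Sum>k | i \<in> e k. of_bool (?P k)) = (of_bool (i \<noteq> j) :: real)"
  proof (cases "i = j")
    case True
    then show ?thesis by (simp add: tree_path_self[OF tree])
  next
    case False
    obtain k where k: "?P k" "i \<in> e k"
      using tree_path_start_edge[OF tree False] by blast
    have uniq: "l = k" if "?P l" "i \<in> e l" for l
      using tree_path_start_edge[OF tree False] k that inj by (metis injD rangeI)
    have "(\<Sum>l | i \<in> e l. of_bool (?P l)) = (\<Sum>l | i \<in> e l. if l = k then 1 else (0::real))"
      using k by (intro sum.cong) (auto dest: uniq)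
    then show ?thesis using k False by simp
  qed
  have signs: "\<sigma> k $ i * \<sigma> k $ j = 1 - 2 * of_bool (?P k)" for k
    by (simp only: sep) (simp add: field_simps)
  have "(\<Sum>k | i \<in> e k. \<sigma> k $ i * \<sigma> k $ j) =
      (\<Sum>k | i \<in> e k. 1) - 2 * (\<Sum>k | i \<in> e k. of_bool (?P k))"
    by (simp only: signs sum_subtractf sum_distrib_left)
  then show ?thesis by (simp only: sep_sum) (simp add: vertex_degree_def)
qed

subsection \<open>Kronecker products with rank-one matrices\<close>

lemma block_matrix_nth [simp]: "block_matrix B $ p $ q = B (fst p) (fst q) $ snd p $ snd q"
  by (simp add: block_matrix_def)

text \<open>\<open>tensor u v M\<close> is \<open>u v\<^sup>T \<otimes> M\<close>.\<close>

definition tensor :: "real^'a \<Rightarrow> real^'b \<Rightarrow> real^'d^'c \<Rightarrow> real^('b \<times> 'd)^('a \<times> 'c)" where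
  "tensor u v M = block_matrix (\<lambda>i j. (u $ i * v $ j) *\<^sub>R M)"

lemma tensor_nth [simp]: "tensor u v M $ p $ q = u $ fst p * v $ fst q * M $ snd p $ snd q"
  by (simp add: tensor_def)

text \<open>Mixed-product rule: the sum over index pairs splits into a scalar product across blocks
  and a matrix product inside them.\<close>

lemma tensor_mult:
  fixes M :: "real^'d^'c" and N :: "real^'g^'d" and v w :: "real^'b"
  shows "tensor u v M ** tensor w z N = (v \<bullet> w) *\<^sub>R tensor u z (M ** N)"
proof -
  have "(\<Sum>r\<in>UNIV. tensor u v M $ p $ r * tensor w z N $ r $ q)
      = (v \<bullet> w) * (u $ fst p * z $ fst q * (M ** N) $ snd p $ snd q)" for p q
  proof -
    have "(\<Sum>r\<in>UNIV. tensor u v M $ p $ r * tensor w z N $ r $ q) =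
      (\<Sum>(b, d) \<in> UNIV \<times> UNIV. (u $ fst p * z $ fst q) * ((v $ b * w $ b) * (M $ snd p $ d * N $ d $ snd q)))"
      unfolding UNIV_Times_UNIV by (intro sum.cong) (auto simp: mult_ac)
    also have "\<dots> = (u $ fst p * z $ fst q) *
        ((\<Sum>b\<in>UNIV. v $ b * w $ b) * (\<Sum>d\<in>UNIV. M $ snd p $ d * N $ d $ snd q))"
      by (simp only: sum.cartesian_product[symmetric] sum_distrib_left[symmetric] sum_product)
    finally show ?thesis
      by (simp add: inner_vec_def matrix_matrix_mult_def mult_ac)
  qed
  then show ?thesis
    by (subst vec_eq_iff) (simp add: vec_eq_iff matrix_matrix_mult_def[of "tensor u v M"])
qed

lemma tensor_zero [simp]: "tensor u v 0 = 0"
  by (simp add: vec_eq_iff)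

lemma tensor_sum: "tensor u v (\<Sum>k\<in>K. M k) = (\<Sum>k\<in>K. tensor u v (M k))"
  by (simp add: vec_eq_iff sum_distrib_left)

section \<open>Bilinearity of the matrix product, and inverses\<close>

lemma matrix_mult_sum_right:
  fixes A :: "real^'b^'a" and B :: "'k \<Rightarrow> real^'c^'b"
  shows "A ** (\<Sum>k\<in>K. B k) = (\<Sum>k\<in>K. A ** B k)"
  by (simp add: matrix_matrix_mult_def vec_eq_iff sum_distrib_left) (rule allI sum.swap)+

lemma matrix_mult_sum_left:
  fixes A :: "'k \<Rightarrow> real^'b^'a" and B :: "real^'c^'b"
  shows "(\<Sum>k\<in>K. A k) ** B = (\<Sum>k\<in>K. A k ** B)"
  by (simp add: matrix_matrix_mult_def vec_eq_iff sum_distrib_right) (rule allI sum.swap)+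

lemma matrix_mult_scaleR [simp]:
  fixes A :: "real^'b^'a" and B :: "real^'c^'b"
  shows "(c *\<^sub>R A) ** B = c *\<^sub>R (A ** B)" "A ** (c *\<^sub>R B) = c *\<^sub>R (A ** B)"
  by (simp_all add: matrix_matrix_mult_def vec_eq_iff sum_distrib_left mult_ac)

lemma matrix_mult_minus [simp]:
  fixes A :: "real^'b^'a" and B :: "real^'c^'b"
  shows "(- A) ** B = - (A ** B)" "A ** (- B) = - (A ** B)"
  by (simp_all add: matrix_matrix_mult_def vec_eq_iff sum_negf)

lemma matrix_mult_diff:
  fixes A A' :: "real^'b^'a" and B B' :: "real^'c^'b"
  shows "(A - A') ** B = A ** B - A' ** B" "A ** (B - B') = A ** B - A ** B'"
  by (simp_all add: matrix_matrix_mult_def vec_eq_iff sum_subtractf algebra_simps)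

lemma matrix_inv_mult:
  fixes A :: "real^'n^'n"
  assumes "invertible A"
  shows "A ** matrix_inv A = mat 1" "matrix_inv A ** A = mat 1"
  using someI_ex[OF assms[unfolded invertible_def]] by (simp_all add: matrix_inv_def)

lemma matrix_inv_eqI:
  fixes A B :: "real^'n^'n"
  assumes "A ** B = mat 1"
  shows "invertible A" "matrix_inv A = B"
proof -
  have "B ** A = mat 1" using assms matrix_left_right_inverse by blast
  then show inv: "invertible A" using assms invertible_def by blast
  show "matrix_inv A = B"
    by (metis assms inv matrix_inv_mult(2) matrix_mul_assoc matrix_mul_lid matrix_mul_rid)
qed

section \<open>Linear algebra of the factorised distance and Laplacian matrices\<close>

text \<open>Separates the algebra from the graph theory. \<open>row\<close> is the entrywise form of
  \<Sum> \<beta>_k \<sigma>_k^T = 2 I - \<delta> 1^T, and \<open>\<delta>_sum\<close> is the degree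
  count 2n - 2(n-1).\<close>

locale tree_factorization =
  fixes src tgt :: "'m::finite \<Rightarrow> 'n::finite" and \<sigma> :: "'m \<Rightarrow> real^'n" and \<delta> :: "real^'n"
    and W :: "'m \<Rightarrow> real^'s^'s" and \<beta> :: "'m \<Rightarrow> real^'n" and D L :: "real^('n \<times> 's)^('n \<times> 's)"
  assumes sign_diff: "\<And>k l. \<sigma> k $ src l - \<sigma> k $ tgt l = (if k = l then 2 else 0)"
    and row: "\<And>i j. (\<Sum>k\<in>UNIV. \<beta> k $ i * \<sigma> k $ j) = 2 * of_bool (i = j) - \<delta> $ i"
    and \<delta>_sum: "\<delta> \<bullet> 1 = 2"
    and \<beta>: "\<And>k. \<beta> k = axis (src k) 1 - axis (tgt k) 1"
    and D: "D = (\<Sum>k\<in>UNIV. (1/2) *\<^sub>R (tensor 1 1 (W k) - tensor (\<sigma> k) (\<sigma> k) (W k)))"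
    and L: "L = (\<Sum>k\<in>UNIV. tensor (\<beta> k) (\<beta> k) (matrix_inv (W k)))"
    and D_inv: "invertible D"
begin

lemma \<beta>_one: "\<beta> k \<bullet> 1 = 0" "1 \<bullet> \<beta> k = 0"
  by (simp_all add: \<beta> inner_diff_left inner_diff_right inner_axis inner_axis')

lemma \<beta>_\<sigma>: "\<beta> k \<bullet> \<sigma> l = (if k = l then 2 else 0)" "\<sigma> l \<bullet> \<beta> k = (if k = l then 2 else 0)"
  using sign_diff[of l k]
  by (auto simp: \<beta> inner_diff_left inner_diff_right inner_axis inner_axis')

lemma \<sigma>_\<delta>: "\<sigma> k \<bullet> \<delta> = 0"
proof -
  \<comment> \<open>Entry \<open>j\<close> of \<sigma>_k^T (\<Sum>_l \<beta>_l \<sigma>_l^T) is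
    evaluated in two ways. They differ by a multiple of 1^T, so one arbitrary entry is
    enough.\<close>
  fix j :: 'n
  have "2 * \<sigma> k $ j = (\<Sum>l\<in>UNIV. (\<sigma> k \<bullet> \<beta> l) * \<sigma> l $ j)"
    by (simp add: \<beta>_\<sigma> if_distrib[of "\<lambda>x. x * _"] cong: if_cong)
  also have "\<dots> = (\<Sum>l\<in>UNIV. \<Sum>i\<in>UNIV. \<sigma> k $ i * (\<beta> l $ i * \<sigma> l $ j))"
    by (simp add: inner_vec_def sum_distrib_right mult.assoc)
  also have "\<dots> = (\<Sum>i\<in>UNIV. \<sigma> k $ i * (2 * of_bool (i = j) - \<delta> $ i))"
    by (subst sum.swap) (simp add: row flip: sum_distrib_left)
  also have "\<dots> = 2 * \<sigma> k $ j - \<sigma> k \<bullet> \<delta>"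
    by (simp add: inner_vec_def right_diff_distrib sum_subtractf of_bool_def
        if_distrib[of "\<lambda>x. _ * x"] cong: if_cong)
  finally show ?thesis by simp
qed

text \<open>\<beta>_k annihilates the all-ones part of \<open>D\<close>, and of the sign terms only
  the k-th survives; its factor 1/2 cancels the scalar product 2.\<close>

lemma tensor_mult_D:
  fixes M :: "real^'s^'c" and u :: "real^'a"
  shows "tensor u (\<beta> k) M ** D = - tensor u (\<sigma> k) (M ** W k)"
proof -
  have "tensor u (\<beta> k) M ** D = (\<Sum>l\<in>UNIV. if k = l then - tensor u (\<sigma> l) (M ** W l) else 0)"
    unfolding D matrix_mult_sum_right
    by (intro sum.cong) (auto simp: matrix_mult_diff tensor_mult \<beta>_one \<beta>_\<sigma>)
  then show ?thesis by simp
qed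

lemma D_mult_tensor:
  fixes M :: "real^'c^'s" and v :: "real^'a"
  shows "D ** tensor (\<beta> k) v M = - tensor (\<sigma> k) v (W k ** M)"
proof -
  have "D ** tensor (\<beta> k) v M = (\<Sum>l\<in>UNIV. if k = l then - tensor (\<sigma> l) v (W l ** M) else 0)"
    unfolding D matrix_mult_sum_left
    by (intro sum.cong) (auto simp: matrix_mult_diff tensor_mult \<beta>_one \<beta>_\<sigma>)
  then show ?thesis by simp
qed

text \<open>A kernel vector x of \<open>W k\<close> would give the kernel vector \<beta>_k \<otimes>
  x of the invertible \<open>D\<close>. Hence the \<open>matrix_inv\<close> in \<open>L\<close> are
  true inverses.\<close>

lemma W_inv: "invertible (W k)"
proof -
  have "x = 0" if "W k *v x = 0" for x
  proof -
    \<comment> \<open>Every column of \<open>X\<close> is \<open>x\<close>, which makes the kernel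
      vector a matrix that \<open>tensor\<close> accepts.\<close>
    define X :: "real^'s^'s" where "X = (\<chi> i j. x $ i)"
    have "W k ** X = 0"
      using that by (simp add: X_def vec_eq_iff matrix_matrix_mult_def matrix_vector_mult_def)
    then have "D ** tensor (\<beta> k) (\<beta> k) X = 0"
      by (simp add: D_mult_tensor)
    then have "matrix_inv D ** (D ** tensor (\<beta> k) (\<beta> k) X) = 0" by simp
    then have "tensor (\<beta> k) (\<beta> k) X = 0"
      by (simp add: matrix_mul_assoc matrix_inv_mult[OF D_inv])
    \<comment> \<open>\<beta>_k has entry 1 at \<open>src k\<close>, so this entry equals
      \<open>x $ i\<close>.\<close>
    then have "tensor (\<beta> k) (\<beta> k) X $ (src k, i) $ (src k, i) = 0" for i by simp
    moreover have "src k \<noteq> tgt k" using sign_diff[of k k] by auto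
    ultimately show ?thesis by (simp add: \<beta> axis_def X_def vec_eq_iff)
  qed
  then have "\<exists>B. B ** W k = mat 1" by (simp add: matrix_left_invertible_ker)
  then show ?thesis by (simp add: invertible_left_inverse)
qed

lemma sum_\<beta>_\<sigma>: "(\<Sum>k\<in>UNIV. tensor (\<beta> k) (\<sigma> k) (mat 1 :: real^'s^'s)) = 2 *\<^sub>R mat 1 - tensor \<delta> 1 (mat 1)"
proof -
  have "(\<Sum>k\<in>UNIV. \<beta> k $ i * \<sigma> k $ j * c) = (2 * of_bool (i = j) - \<delta> $ i) * c" for i j c
    by (simp add: row flip: sum_distrib_right)
  then show ?thesis by (auto simp: vec_eq_iff mat_def)
qed

lemma sum_\<sigma>_\<beta>: "(\<Sum>k\<in>UNIV. tensor (\<sigma> k) (\<beta> k) (mat 1 :: real^'s^'s)) = 2 *\<^sub>R mat 1 - tensor 1 \<delta> (mat 1)"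
proof -
  have "(\<Sum>k\<in>UNIV. \<sigma> k $ i * \<beta> k $ j * c) = (2 * of_bool (i = j) - \<delta> $ j) * c" for i j c
    using row[of j i] by (simp add: mult.commute[of "\<sigma> _ $ _"] eq_commute flip: sum_distrib_right)
  then show ?thesis by (auto simp: vec_eq_iff mat_def)
qed

lemma LD: "L ** D = tensor \<delta> 1 (mat 1) - 2 *\<^sub>R mat 1"
  unfolding L matrix_mult_sum_left tensor_mult_D
  by (simp add: matrix_inv_mult[OF W_inv] sum_negf sum_\<beta>_\<sigma>)

lemma DL: "D ** L = tensor 1 \<delta> (mat 1) - 2 *\<^sub>R mat 1"
  unfolding L matrix_mult_sum_right D_mult_tensor
  by (simp add: matrix_inv_mult[OF W_inv] sum_negf sum_\<sigma>_\<beta>)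

lemma L_mult_one: "L ** tensor 1 v M = 0" and one_mult_L: "tensor u 1 N ** L = 0"
  by (simp_all add: L matrix_mult_sum_left matrix_mult_sum_right tensor_mult \<beta>_one)

lemma LDL: "L ** D ** L = (-2) *\<^sub>R L"
  by (simp add: LD matrix_mult_diff one_mult_L)

text \<open>The sign terms vanish by \<open>\<sigma>_\<delta>\<close>, and the scalar product of 1
  and \<delta> is 2, which cancels the factor 1/2.\<close>

lemma D_mult_\<delta>: "D ** tensor \<delta> 1 (mat 1) = tensor 1 1 (\<Sum>k\<in>UNIV. W k)"
  using \<delta>_sum by (simp add: D matrix_mult_sum_left matrix_mult_diff tensor_mult \<sigma>_\<delta> tensor_sum inner_commute[of 1])

text \<open>Up to the factor 1/3, the four products are I, 2 I - \<delta> 1^T \<otimes> I, \<delta>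
  1^T \<otimes> I and 0, with total 3 I.\<close>

lemma inverse_diff:
  "(matrix_inv D - L) ** ((1/3) *\<^sub>R D + (1/3) *\<^sub>R tensor 1 1 (\<Sum>k\<in>UNIV. W k)) = mat 1"
proof -
  have "matrix_inv D ** tensor 1 1 (\<Sum>k\<in>UNIV. W k) = tensor \<delta> 1 (mat 1)"
    by (simp add: matrix_mul_assoc matrix_inv_mult[OF D_inv] flip: D_mult_\<delta>)
  then have "(matrix_inv D - L) ** ((1/3) *\<^sub>R D + (1/3) *\<^sub>R tensor 1 1 (\<Sum>k\<in>UNIV. W k)) =
    (1/3) *\<^sub>R (mat 1 + 2 *\<^sub>R mat 1)"
    by (simp add: matrix_add_ldistrib matrix_mult_diff matrix_inv_mult[OF D_inv] LD L_mult_one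
        flip: scaleR_add_right)
  also have "\<dots> = mat 1" by (simp add: vec_eq_iff)
  finally show ?thesis .
qed

text \<open>The (k, l) block carries the scalar -(\<sigma>_k \<bullet> \<beta>_l), which is -2 on
  the diagonal and 0 elsewhere. Square roots enter only through the hypothesis on
  \<open>S\<close>.\<close>

lemma incidence_congruence:
  fixes S :: "'m \<Rightarrow> real^'s^'s"
  assumes Q: "Q = (\<Sum>k\<in>UNIV. tensor (\<beta> k) (axis k 1) (S k))"
    and S: "\<And>k. transpose (S k) ** W k ** S k = mat 1"
  shows "transpose Q ** D ** Q = (-2) *\<^sub>R mat 1"
proof -
  have Qt: "transpose Q = (\<Sum>k\<in>UNIV. tensor (axis k 1) (\<beta> k) (transpose (S k)))"
    unfolding Q by (simp add: vec_eq_iff transpose_def mult.commute)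
  have blocks: "tensor (axis k 1) (\<beta> k) (transpose (S k)) ** D ** tensor (\<beta> l) (axis l 1) (S l) =
      (if k = l then (-2) *\<^sub>R tensor (axis k 1) (axis k 1) (mat 1) else 0)" for k l
    by (auto simp: tensor_mult_D tensor_mult \<beta>_\<sigma> S)
  have "transpose Q ** D ** Q = (\<Sum>k\<in>UNIV. (-2) *\<^sub>R tensor (axis k 1) (axis k 1) (mat 1))"
    unfolding Qt unfolding Q by (simp add: matrix_mult_sum_left matrix_mult_sum_right blocks)
  also have "\<dots> = (-2) *\<^sub>R (\<Sum>k\<in>UNIV. tensor (axis k 1) (axis k 1) (mat 1))"
    by (simp only: scaleR_sum_right)
  also have "(\<Sum>k\<in>UNIV. tensor (axis k 1) (axis k 1) (mat 1)) = (mat 1 :: real^('m \<times> 's)^('m \<times> 's))"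
    by (auto simp: vec_eq_iff mat_def axis_def if_distrib[of "\<lambda>x. x * _"] cong: if_cong)
  finally show ?thesis .
qed

end

section \<open>Factorising the matrices of a weighted tree\<close>

lemma kronecker_rank_one:
  fixes u v :: "real^'n"
  shows "(columnvector u ** (rowvector v :: real^'n^1)) \<otimes>\<^sub>K M = tensor u v M"
  by (simp add: vec_eq_iff kronecker_def columnvector_def rowvector_def matrix_matrix_mult_def)

lemma kronecker_scaled_identity: "(c *\<^sub>R mat 1) \<otimes>\<^sub>K mat 1 = c *\<^sub>R mat 1"
  by (simp add: vec_eq_iff kronecker_def mat_def)

lemma orientation_exists:
  assumes "simple_graph (range e)"
  obtains src tgt where "orientation e src tgt"
proof -
  have "\<forall>k. \<exists>x y. e k = {x, y}"
    using assms unfolding simple_graph_def card_2_iff by blast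
  then show ?thesis using that unfolding orientation_def by metis
qed

lemma orientation_distinct:
  assumes "simple_graph (range e)" "orientation e src tgt"
  shows "src k \<noteq> tgt k"
proof
  assume "src k = tgt k"
  then have "card (e k) = 1" using assms(2) by (simp add: orientation_def)
  then show False using assms(1) by (simp add: simple_graph_def)
qed

definition edge_vector :: "('m \<Rightarrow> 'n::finite) \<Rightarrow> ('m \<Rightarrow> 'n) \<Rightarrow> 'm \<Rightarrow> real^'n" where
  "edge_vector src tgt k = axis (src k) 1 - axis (tgt k) 1"

lemma edge_vector_nth: "edge_vector src tgt k $ i = of_bool (i = src k) - of_bool (i = tgt k)"
  by (simp add: edge_vector_def axis_def)

text \<open>The product of two entries of the edge vector is 1 on the diagonal at an end of the
  edge, -1 between its two ends and 0 otherwise, whatever the orientation.\<close>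

lemma laplacian_matrix_eq:
  assumes simple: "simple_graph (range e)" and inj: "inj e" and ori: "orientation e src tgt"
  shows "laplacian_matrix e M =
    (\<Sum>k\<in>UNIV. tensor (edge_vector src tgt k) (edge_vector src tgt k) (M k))"
proof -
  let ?\<beta> = "edge_vector src tgt"
  have e: "e k = {src k, tgt k}" and ne: "src k \<noteq> tgt k" for k
    using ori orientation_distinct[OF simple ori] by (simp_all add: orientation_def)
  have "(if i = j then \<Sum>k | i \<in> e k. M k
         else if {i, j} \<in> range e then - M (THE k. e k = {i, j}) else 0)
      = (\<Sum>k\<in>UNIV. (?\<beta> k $ i * ?\<beta> k $ j) *\<^sub>R M k)" for i j
  proof -
    consider "i = j" | k where "i \<noteq> j" "e k = {i, j}" | "i \<noteq> j" "{i, j} \<notin> range e"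
      by (metis rangeE)
    then show ?thesis
    proof cases
      case 1
      have "(\<Sum>k | i \<in> e k. M k) = (\<Sum>k\<in>UNIV. if i \<in> e k then M k else 0)"
        using sum.inter_filter[of UNIV M "\<lambda>k. i \<in> e k"] by simp
      also have "\<dots> = (\<Sum>k\<in>UNIV. (?\<beta> k $ i * ?\<beta> k $ i) *\<^sub>R M k)"
      proof (intro sum.cong refl)
        fix k
        show "(if i \<in> e k then M k else 0) = (?\<beta> k $ i * ?\<beta> k $ i) *\<^sub>R M k"
          using ne[of k] by (auto simp: edge_vector_nth e)
      qed
      finally show ?thesis using 1 by simp
    next
      case 2
      \<comment> \<open>Injectivity of \<open>e\<close> makes the definite description pick out
        \<open>k\<close>.\<close>
      have the_edge: "(THE l. e l = {i, j}) = k"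
        using 2 inj by (intro the_equality) (auto simp: inj_def)
      have "?\<beta> l $ i * ?\<beta> l $ j = (if l = k then - 1 else 0)" for l
      proof (cases "l = k")
        case True
        have "i = src k \<and> j = tgt k \<or> i = tgt k \<and> j = src k"
          using 2 e[of k] by (auto simp: doubleton_eq_iff)
        then show ?thesis using True ne[of k] by (auto simp: edge_vector_nth)
      next
        case False
        then have "{src l, tgt l} \<noteq> {i, j}" using 2 e[of l] inj by (metis injD)
        then show ?thesis using False 2 by (auto simp: edge_vector_nth)
      qed
      then show ?thesis using 2 the_edge by (auto simp: if_distrib[of "\<lambda>c. c *\<^sub>R _"] cong: if_cong)
    next
      case 3
      have "?\<beta> l $ i * ?\<beta> l $ j = 0" for l
      proof -
        have "{src l, tgt l} \<noteq> {i, j}" using 3 e[of l] by (metis rangeI)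
        then show ?thesis using 3 by (auto simp: edge_vector_nth)
      qed
      then have "(\<Sum>l\<in>UNIV. (?\<beta> l $ i * ?\<beta> l $ j) *\<^sub>R M l) = 0"
        by (intro sum.neutral ballI) (simp only: scaleR_zero_left)
      then show ?thesis using 3 by simp
    qed
  qed
  then have "laplacian_matrix e M = block_matrix (\<lambda>i j. \<Sum>k\<in>UNIV. (?\<beta> k $ i * ?\<beta> k $ j) *\<^sub>R M k)"
    unfolding laplacian_matrix_def by presburger
  also have "\<dots> = (\<Sum>k\<in>UNIV. tensor (?\<beta> k) (?\<beta> k) (M k))"
    by (simp add: vec_eq_iff)
  finally show ?thesis .
qed

lemma distance_matrix_eq:
  fixes \<sigma> :: "'m::finite \<Rightarrow> real^'n"
  assumes sep: "\<And>k i j. of_bool (e k \<in> path_edges (tree_path (range e) i j)) = (1 - \<sigma> k $ i * \<sigma> k $ j) / 2"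
  shows "distance_matrix e W = (\<Sum>k\<in>UNIV. (1/2) *\<^sub>R (tensor 1 1 (W k) - tensor (\<sigma> k) (\<sigma> k) (W k)))"
proof -
  have "(\<Sum>k | e k \<in> path_edges (tree_path (range e) i j). W k)
      = (\<Sum>k\<in>UNIV. ((1 - \<sigma> k $ i * \<sigma> k $ j) / 2) *\<^sub>R W k)" for i j
  proof -
    let ?P = "\<lambda>k. e k \<in> path_edges (tree_path (range e) i j)"
    have "(\<Sum>k | ?P k. W k) = (\<Sum>k\<in>UNIV. if ?P k then W k else 0)"
      using sum.inter_filter[of UNIV W ?P] by simp
    also have "\<dots> = (\<Sum>k\<in>UNIV. of_bool (?P k) *\<^sub>R W k)"
      by (intro sum.cong) auto
    finally show ?thesis by (simp only: sep)
  qed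
  then have "distance_matrix e W =
      block_matrix (\<lambda>i j. \<Sum>k\<in>UNIV. ((1 - \<sigma> k $ i * \<sigma> k $ j) / 2) *\<^sub>R W k)"
    unfolding distance_matrix_def by presburger
  also have "\<dots> = (\<Sum>k\<in>UNIV. (1/2) *\<^sub>R (tensor 1 1 (W k) - tensor (\<sigma> k) (\<sigma> k) (W k)))"
    unfolding vec_eq_iff by (simp add: left_diff_distrib diff_divide_distrib)
  finally show ?thesis .
qed

text \<open>\<open>axis k 1\<close> places the k-th term in block column \<open>k\<close>. The ends
  must differ: for a loop the case distinction would select the source sign, whereas the edge vector
  would be 0.\<close>

lemma incidence_matrix_eq:
  fixes src tgt :: "'m::finite \<Rightarrow> 'n::finite"
  assumes "\<And>k. src k \<noteq> tgt k"
  shows "incidence_matrix src tgt W =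
    (\<Sum>k\<in>UNIV. tensor (edge_vector src tgt k) (axis k 1) (matrix_inv (pd_sqrt (W k))))"
proof -
  let ?S = "\<lambda>k. matrix_inv (pd_sqrt (W k))"
  have "(\<Sum>l\<in>UNIV. edge_vector src tgt l $ i * axis l 1 $ k * ?S l $ a $ b)
      = edge_vector src tgt k $ i * ?S k $ a $ b" for i k a b
  proof -
    have "(\<Sum>l\<in>UNIV. edge_vector src tgt l $ i * axis l 1 $ k * ?S l $ a $ b)
        = (\<Sum>l\<in>UNIV. if l = k then edge_vector src tgt k $ i * ?S k $ a $ b else 0)"
      by (intro sum.cong) (auto simp: axis_def)
    then show ?thesis by simp
  qed
  then show ?thesis
    using assms by (auto simp: vec_eq_iff incidence_matrix_def edge_vector_nth)
qed

text \<open>Handshake: incident pairs of a vertex and an edge are counted in both orders.\<close>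

lemma degree_sum:
  fixes e :: "'m::finite \<Rightarrow> 'n::finite set"
  assumes "simple_graph (range e)"
  shows "(\<Sum>i\<in>UNIV. vertex_degree e i) = 2 * CARD('m)"
proof -
  have "(\<Sum>i\<in>UNIV. vertex_degree e i) = (\<Sum>i\<in>UNIV. \<Sum>k\<in>UNIV. of_bool (i \<in> e k))"
    by (simp add: vertex_degree_def)
  also have "\<dots> = (\<Sum>k\<in>UNIV. card (e k))"
    by (subst sum.swap) simp
  also have "\<dots> = 2 * CARD('m)"
    using assms by (simp add: simple_graph_def)
  finally show ?thesis .
qed

lemma tree_factorization_exists:
  fixes e :: "'m::finite \<Rightarrow> 'n::finite set" and W :: "'m \<Rightarrow> real^'s^'s"
  assumes m: "CARD('m) = CARD('n) - 1" and inj: "inj e" and tree: "is_tree (range e)"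
    and ori: "orientation e src tgt" and inv: "invertible (distance_matrix e W)"
  obtains \<sigma> where "tree_factorization src tgt \<sigma> (\<chi> i. 2 - real (vertex_degree e i)) W
    (edge_vector src tgt) (distance_matrix e W) (laplacian_matrix e (\<lambda>k. matrix_inv (W k)))"
proof -
  obtain \<sigma> :: "'m \<Rightarrow> real^'n" where
    pm: "\<And>k i. \<sigma> k $ i = 1 \<or> \<sigma> k $ i = -1"
    and diff: "\<And>k l. \<sigma> k $ src l - \<sigma> k $ tgt l = (if k = l then 2 else 0)"
    and sep: "\<And>k i j. of_bool (e k \<in> path_edges (tree_path (range e) i j)) = (1 - \<sigma> k $ i * \<sigma> k $ j) / 2"
    by (rule tree_edge_signs[OF tree inj ori]) (rule that)
  have simple: "simple_graph (range e)" using tree by (simp add: is_tree_def)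
  note ne = orientation_distinct[OF simple ori]
  have ends: "\<sigma> k $ src k = 1" "\<sigma> k $ tgt k = -1" for k
    using pm[of k "src k"] pm[of k "tgt k"] diff[of k k] by auto
  \<comment> \<open>The edge vector is the sign vector restricted to the two ends, which turns
    \<open>row\<close> into \<open>incidence_sign_sum\<close>.\<close>
  have \<beta>: "edge_vector src tgt k $ i = (if i \<in> e k then \<sigma> k $ i else 0)" for k i
  proof -
    have "e k = {src k, tgt k}" using ori by (simp add: orientation_def)
    then show ?thesis using ends[of k] ne[of k] by (auto simp: edge_vector_nth)
  qed
  have row: "(\<Sum>k\<in>UNIV. edge_vector src tgt k $ i * \<sigma> k $ j)
      = 2 * of_bool (i = j) - (\<chi> i. 2 - real (vertex_degree e i)) $ i" for i j
  proof -
    have "(\<Sum>k\<in>UNIV. edge_vector src tgt k $ i * \<sigma> k $ j)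
        = (\<Sum>k\<in>UNIV. if i \<in> e k then \<sigma> k $ i * \<sigma> k $ j else 0)"
      by (intro sum.cong) (auto simp: \<beta>)
    also have "\<dots> = (\<Sum>k | i \<in> e k. \<sigma> k $ i * \<sigma> k $ j)"
      using sum.inter_filter[of UNIV "\<lambda>k. \<sigma> k $ i * \<sigma> k $ j" "\<lambda>k. i \<in> e k"] by simp
    also have "\<dots> = real (vertex_degree e i) - 2 * of_bool (i \<noteq> j)"
      by (rule incidence_sign_sum[OF tree inj sep])
    finally show ?thesis by simp
  qed
  have "(\<chi> i. 2 - real (vertex_degree e i)) \<bullet> (1 :: real^'n)
      = 2 * real CARD('n) - real (\<Sum>i\<in>UNIV. vertex_degree e i)"
    by (simp add: inner_vec_def sum_subtractf)
  \<comment> \<open>Since n is positive, the truncated subtraction in \<open>m\<close> is a true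
    one.\<close>
  also have "\<dots> = 2"
    using m zero_less_card_finite[where 'a = 'n] by (simp add: degree_sum[OF simple] of_nat_diff)
  finally have "tree_factorization src tgt \<sigma> (\<chi> i. 2 - real (vertex_degree e i)) W
    (edge_vector src tgt) (distance_matrix e W) (laplacian_matrix e (\<lambda>k. matrix_inv (W k)))"
    using diff row inv
    by unfold_locales
      (simp_all add: distance_matrix_eq[OF sep] laplacian_matrix_eq[OF simple inj ori] edge_vector_def)
  then show ?thesis by (rule that)
qed

text \<open>With \<open>?R\<close> the symmetric square root and \<open>S\<close> its inverse, S^T R
  = (R S)^T = I, so S^T (R R) S collapses.\<close>

lemma inverse_pd_sqrt_congruence:
  fixes A :: "real^'s^'s"
  assumes "positive_definite A"
  defines "S \<equiv> matrix_inv (pd_sqrt A)"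
  shows "transpose S ** A ** S = mat 1"
proof -
  let ?R = "pd_sqrt A"
  note R = pd_sqrt[OF assms(1)]
  have "x = 0" if "?R *v x = 0" for x
    using R(1) that by (metis inner_zero_right less_irrefl positive_definite_def)
  then have inv: "invertible ?R"
    by (simp add: invertible_left_inverse matrix_left_invertible_ker)
  have "transpose ?R = ?R" using R(1) by (simp add: positive_definite_def)
  then have "transpose S ** ?R = transpose (?R ** S)"
    by (simp add: matrix_transpose_mul)
  then have SR: "transpose S ** ?R = mat 1"
    by (simp add: S_def matrix_inv_mult[OF inv] transpose_mat)
  have "transpose S ** A ** S = transpose S ** (?R ** ?R) ** S"
    by (simp only: R(2))
  also have "\<dots> = (transpose S ** ?R) ** (?R ** S)"
    by (simp only: matrix_mul_assoc)
  also have "\<dots> = mat 1"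
    unfolding SR by (simp add: S_def matrix_inv_mult[OF inv])
  finally show ?thesis .
qed

theorem theorem3p3:
  fixes e :: "'m::finite \<Rightarrow> 'n::finite set"
    and W :: "'m \<Rightarrow> real^'s^'s"
    and D L :: "real^('n \<times> 's)^('n \<times> 's)"
    and \<delta> ones :: "real^'n"
    and J :: "real^'n^'n"
  assumes n: "CARD('n) \<ge> 2"
    and m: "CARD('m) = CARD('n) - 1"
    and inj: "inj e"
    and tree: "is_tree (range e)"
    and D: "D = distance_matrix e W"
    and inv: "invertible D"
    and L: "L = laplacian_matrix e (\<lambda>k. matrix_inv (W k))"
    and \<delta>: "\<delta> = (\<chi> i. 2 - real (vertex_degree e i))"
    and ones: "ones = (\<chi> i. 1)"
    and J: "J = (\<chi> i j. 1)"
  shows "L ** D = (columnvector \<delta> ** (rowvector ones :: real^'n^1)) \<otimes>\<^sub>K mat 1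
           - (2 *\<^sub>R mat 1) \<otimes>\<^sub>K mat 1 \<and>
         D ** L = (columnvector ones ** (rowvector \<delta> :: real^'n^1)) \<otimes>\<^sub>K mat 1
           - (2 *\<^sub>R mat 1) \<otimes>\<^sub>K mat 1 \<and>
         L ** D ** L = (-2) *\<^sub>R L \<and>
         (invertible (matrix_inv D - L) \<and>
          matrix_inv (matrix_inv D - L)
            = (1/3) *\<^sub>R D + (1/3) *\<^sub>R (J \<otimes>\<^sub>K (\<Sum>k\<in>UNIV. W k))) \<and>
         ((\<forall>k. positive_definite (W k)) \<longrightarrow>
           (\<forall>src tgt. orientation e src tgt \<longrightarrow>
             transpose (incidence_matrix src tgt W) ** D ** incidence_matrix src tgt W
               = (-2) *\<^sub>R mat 1))"
proof -
  have simple: "simple_graph (range e)" using tree by (simp add: is_tree_def)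
  have inv': "invertible (distance_matrix e W)" using inv D by simp
  have ones': "ones = 1" by (simp add: ones vec_eq_iff)
  have J': "J \<otimes>\<^sub>K M = tensor 1 1 M" for M :: "real^'s^'s"
    by (simp add: J vec_eq_iff kronecker_def)
  \<comment> \<open>Part (v) ranges over all orientations, so the factorisation is obtained afresh
    for each; \<open>D\<close> and \<open>L\<close> stay the same.\<close>
  have incidence: "transpose (incidence_matrix s t W) ** D ** incidence_matrix s t W = (-2) *\<^sub>R mat 1"
    if pd: "\<forall>k. positive_definite (W k)" and ori: "orientation e s t" for s t
  proof -
    from tree_factorization_exists[OF m inj tree ori inv'] obtain \<tau> where
      "tree_factorization s t \<tau> \<delta> W (edge_vector s t) D L"
      unfolding D L \<delta> .
    then show ?thesis
      by (rule tree_factorization.incidence_congruence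
          [OF _ incidence_matrix_eq[OF orientation_distinct[OF simple ori]]])
        (use pd in \<open>simp add: inverse_pd_sqrt_congruence\<close>)
  qed
  \<comment> \<open>Parts (i) to (iv) do not mention an orientation, so any one serves.\<close>
  obtain src tgt where "orientation e src tgt" using orientation_exists[OF simple] .
  from tree_factorization_exists[OF m inj tree this inv'] obtain \<sigma> where
    "tree_factorization src tgt \<sigma> \<delta> W (edge_vector src tgt) D L"
    unfolding D L \<delta> .
  then interpret tree_factorization src tgt \<sigma> \<delta> W "edge_vector src tgt" D L .
  show ?thesis
    unfolding ones' J' kronecker_rank_one kronecker_scaled_identity
    using LD DL LDL matrix_inv_eqI[OF inverse_diff] incidence by blast
qed

end
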